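(* Let $N\in\mathbb{N}$ and $a,b,c\in\mathbb{N}$ with $0\le a\le N$, $0\le b\le N$, $b\le a$, $a+b\le N$ and $0\le c\le N-a-b$. Then $$\frac{\binom{N-b}{a+c}\binom{N-a}{c}}{\binom{N}{a+c}^2}\sum_{n=0}^b\frac{(-b)_n\,(c+a-N)_n\,(a+c+1)_n\,(a+c+1)_n}{n!\,(c+1)_n\,(a+c-N)_n\,(a+c-N)_n}\;{}_4F_3\left(\begin{matrix}-a,\;-a-c,\;N-a-c-n+1,\;N-a-c-n+1\\N-a-b-c+1,\;-a-c-n,\;-a-c-n\end{matrix};1\right)$$ $$=\frac{N+1}{N-a+1}\binom{N}{b}^{-1}\sum_{m=0}^b\frac{(-a)_m\,(N-b+m+2)_{b-m}\,(-1)^m}{(N-a+2)_m\,(b-m)!}.$$ In particular, the left-hand side is independent of $c$ in the stated range.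
   Context: $\mathbb{N}=\{0,1,2,\dots\}$; $(x)_k=x(x+1)\cdots(x+k-1)$, $(x)_0=1$. ${}_4F_3\left(\begin{smallmatrix}\alpha_1,\alpha_2,\alpha_3,\alpha_4\\\beta_1,\beta_2,\beta_3\end{smallmatrix};z\right)=\sum_{k\ge0}\frac{(\alpha_1)_k(\alpha_2)_k(\alpha_3)_k(\alpha_4)_k}{(\beta_1)_k(\beta_2)_k(\beta_3)_k\,k!}z^k$; here the series terminates because of the upper parameter $-a$ (only the terms $k\le a$ are included). *)

theory Defs
  imports "HOL-Analysis.Analysis"
begin

definition hyp_4F3 ::
    "real \<Rightarrow> real \<Rightarrow> real \<Rightarrow> real \<Rightarrow> real \<Rightarrow> real \<Rightarrow> real \<Rightarrow> real \<Rightarrow> real" where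
  "hyp_4F3 a1 a2 a3 a4 b1 b2 b3 z = eval_fps (fps_hypergeo [a1, a2, a3, a4] [b1, b2, b3] 1) z"

lemma hyp_4F3_series:
  "hyp_4F3 a1 a2 a3 a4 b1 b2 b3 z =
     (\<Sum>k. (pochhammer a1 k * pochhammer a2 k * pochhammer a3 k * pochhammer a4 k) /
          (pochhammer b1 k * pochhammer b2 k * pochhammer b3 k * fact k) * z ^ k)"
  by (simp add: hyp_4F3_def eval_fps_def mult.assoc)

text \<open>
  With upper parameter \<open>- a\<close> (\<open>a\<close> a natural number) the series is the finite sum over \<open>k \<le> a\<close>, even
  if lower parameters are negative integers: the numerator vanishes for \<open>k > a\<close>, and
  \<open>0 / 0 = 0\<close> in HOL, so the later terms contribute nothing.
\<close>

lemma hyp_4F3_terminating: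
  "hyp_4F3 (- real a) a2 a3 a4 b1 b2 b3 z =
     (\<Sum>k\<le>a. (pochhammer (- real a) k * pochhammer a2 k * pochhammer a3 k * pochhammer a4 k) /
          (pochhammer b1 k * pochhammer b2 k * pochhammer b3 k * fact k) * z ^ k)"
  unfolding hyp_4F3_series
  by (rule suminf_finite) (auto simp: pochhammer_of_nat_eq_0_iff)

definition hyp_double_sum :: "nat \<Rightarrow> nat \<Rightarrow> nat \<Rightarrow> nat \<Rightarrow> real" where
  "hyp_double_sum N a b c =
     real ((N - b) choose (a + c)) * real ((N - a) choose c) / (real (N choose (a + c)))\<^sup>2 *
     (\<Sum>n = 0..b.
        (pochhammer (- real b) n * pochhammer (real c + real a - real N) n *
         pochhammer (real a + real c + 1) n * pochhammer (real a + real c + 1) n) /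
        (fact n * pochhammer (real c + 1) n *
         pochhammer (real a + real c - real N) n * pochhammer (real a + real c - real N) n) *
        hyp_4F3
          (- real a) (- real a - real c)
          (real N - real a - real c - real n + 1) (real N - real a - real c - real n + 1)
          (real N - real a - real b - real c + 1)
          (- real a - real c - real n) (- real a - real c - real n)
          1)"

end

theory Submission
  imports Defs
begin

text \<open>
  Substitute \<open>y = a - k\<close> for the summation index \<open>k\<close> of the inner series. When every Pochhammer symbol is turned into a quotient of factorials all signs cancel, and
  with \<open>t = c + n + y\<close> the left-hand side, multiplied by \<open>C(N,a) C(N,b)\<close>, becomes the sum of
  \<open>C(t,n) C(N-t,b-n) C(t,y) C(N-t,a-y)\<close> over \<open>n \<le> b\<close>, \<open>y \<le> a\<close>
  (\<open>hyp_double_sum_eq_sum_binomial_products\<close>). In the same way the right-hand side, multiplied by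
  \<open>C(N,a) C(N,b)\<close>, becomes the sum of \<open>C(N+1,b-m) C(N+1,a-m)\<close> over \<open>m \<le> b\<close>
  (\<open>pochhammer_sum_eq_sum_binomial_products\<close>), in which \<open>c\<close> no longer occurs.

  The two sums agree by a generating function
  (\<open>sum_binomial_products_shift_invariant\<close>). For \<open>A = (1 + u z) (1 + v z)\<close> and
  \<open>B = (1 + u) (1 + v)\<close>, the summands with a given \<open>t = c + n + y\<close> add up to the coefficient
  of \<open>u^b v^a z^(t-c)\<close> in \<open>A^t B^(N-t)\<close>. The whole sum is therefore the coefficient of
  \<open>u^b v^a z^(N-c)\<close> in \<open>P = (\<Sum>t\<le>N. A^t (z B)^(N-t))\<close>, a geometric sum. What makes it computable is
  the factorisation \<open>A - z B = (1 - z) (1 - u v z)\<close>, which gives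
  \<open>(1 - z) (1 - u v z) P = A^(N+1) - z^(N+1) B^(N+1)\<close>. The last term cannot reach degree \<open>N - c\<close> in
  \<open>z\<close>, so only \<open>A^(N+1) / ((1 - z) (1 - u v z))\<close> contributes. The factor \<open>(u v z)^m\<close> leaves
  \<open>u^(b-m) v^(a-m)\<close> to be taken from \<open>A^(N+1)\<close>, where it carries \<open>z^(a+b-2m)\<close>, and the factor
  \<open>1 / (1 - z)\<close> supplies the missing powers of \<open>z\<close>; there is room for them because
  \<open>a + b \<le> N - c\<close>.
\<close>

section \<open>Coefficients of power series over a commutative ring\<close>

unbundle no vec_syntax
unbundle fps_syntax

lemma fps_nth_binomial_linear:
  fixes u :: "'a::comm_ring_1"
  shows "((1 + fps_const u * fps_X) ^ t) $ k = of_nat (t choose k) * u ^ k"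
proof -
  have "((1 + fps_const u * fps_X) ^ t) = (\<Sum>i\<le>t. of_nat (t choose i) * (fps_const u * fps_X) ^ i)"
    by (subst add.commute, subst binomial_ring) simp
  also have "\<dots> = (\<Sum>i\<le>t. fps_const (of_nat (t choose i) * u ^ i) * fps_X ^ i)"
    by (intro sum.cong refl)
      (simp add: power_mult_distrib fps_of_nat [symmetric] mult.assoc [symmetric]
        fps_const_mult [symmetric] del: fps_const_mult)
  finally have "((1 + fps_const u * fps_X) ^ t) $ k
      = (\<Sum>i\<le>t. if i = k then of_nat (t choose i) * u ^ i else 0)"
    by (simp add: fps_sum_nth fps_X_power_nth if_distrib eq_commute [of k] cong: if_cong)
  also have "\<dots> = of_nat (t choose k) * u ^ k"
    by (simp add: sum.delta binomial_eq_0)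
  finally show ?thesis .
qed

text \<open>
  Dividing by \<open>1 - X\<close> sums coefficients and dividing by \<open>1 - w X\<close> convolves with powers of \<open>w\<close>. The
  quotient is described by an equation because the coefficients form only a ring; the remainder
  \<open>X^(N+1) G\<close> stays out of the degrees considered.
\<close>
lemma fps_nth_quotient_by_one_minus:
  fixes P F :: "'a::comm_ring_1 fps"
  assumes "(1 - fps_X) * (1 - fps_const w * fps_X) * P = F + fps_X ^ Suc N * G" and "n \<le> N"
  shows "P $ n = (\<Sum>m\<le>n. w ^ m * (\<Sum>k\<le>n - m. F $ k))"
proof -
  define geom where "geom = (\<lambda>x::'a. Abs_fps (\<lambda>m. x ^ m))"
  have geom: "geom x * (1 - fps_const x * fps_X) = 1" for x
  proof (rule fps_ext)
    fix i show "(geom x * (1 - fps_const x * fps_X)) $ i = 1 $ i"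
      unfolding right_diff_distrib mult.assoc [symmetric]
      by (cases i) (simp_all add: geom_def fps_X_mult_right_nth)
  qed
  have "P = (geom 1 * (1 - fps_const 1 * fps_X)) * (geom w * (1 - fps_const w * fps_X)) * P"
    by (simp only: geom mult_1)
  also have "\<dots> = geom w * geom 1 * ((1 - fps_X) * (1 - fps_const w * fps_X) * P)"
    by (simp add: mult_ac)
  also have "\<dots> = geom w * (geom 1 * F) + fps_X ^ Suc N * (geom w * geom 1 * G)"
    unfolding assms(1) by (simp add: distrib_left mult_ac del: power_Suc)
  finally have "P $ n = (geom w * (geom 1 * F)) $ n"
    using assms(2) by (simp add: fps_X_power_mult_nth del: power_Suc)
  also have "\<dots> = (\<Sum>m\<le>n. w ^ m * (\<Sum>k\<le>n - m. F $ k))"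
    by (simp add: fps_mult_nth [of "geom w"] mult.commute [of "geom 1"])
       (simp add: fps_mult_nth geom_def atLeast0AtMost)
  finally show ?thesis .
qed

lemma fps_nth_X_power_mult_binomial:
  "((fps_X :: 'a::comm_ring_1 fps) ^ x * (1 + fps_X) ^ r) $ b =
     (if x \<le> b then of_nat (r choose (b - x)) else 0)"
  using fps_nth_binomial_linear [of "1::'a" r "b - x"] by (simp add: fps_X_power_mult_nth)

section \<open>The binomial identity\<close>

text \<open>
  The proof works in the power series in \<open>z\<close> over those in \<open>v\<close> over those in \<open>u\<close>, so that
  \<open>f $ k $ a $ b\<close> is the coefficient of \<open>z^k v^a u^b\<close>, and computes the coefficient of
  \<open>z^(N-c) v^a u^b\<close> in \<open>P\<close> twice: from the factorisation of \<open>A - z B\<close>, and term by term.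
\<close>
lemma sum_binomial_products_shift_invariant:
  fixes N a b c :: nat
  assumes "b \<le> a" and "a + b + c \<le> N"
  defines "g \<equiv> \<lambda>t x y. (t choose x) * (t choose y) * ((N - t) choose (b - x)) * ((N - t) choose (a - y))"
  shows "(\<Sum>x\<le>b. \<Sum>y\<le>a. g (c + x + y) x y)
       = (\<Sum>m\<le>b. (Suc N choose (b - m)) * (Suc N choose (a - m)))"
proof -
  define u v :: "int fps fps" where "u = fps_const fps_X" and "v = fps_X"
  define z :: "int fps fps fps" where "z = fps_X"
  define A where "A = (1 + fps_const u * z) * (1 + fps_const v * z)"
  define B where "B = (1 + u) * (1 + v)"
  define P where "P = (\<Sum>t<Suc N. A ^ t * (z * fps_const B) ^ (N - t))"

  have coeff_uv: "((u ^ x * (1 + u) ^ r) * (v ^ y * (1 + v) ^ s)) $ a $ b =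
      (if x \<le> b \<and> y \<le> a then int (r choose (b - x)) * int (s choose (a - y)) else 0)" for x y r s
  proof -
    have "u ^ x * (1 + u) ^ r = fps_const (fps_X ^ x * (1 + fps_X) ^ r)"
    proof -
      have "1 + u = fps_const (1 + fps_X)"
        by (simp add: u_def flip: fps_const_add)
      then show ?thesis by (simp only: u_def fps_const_power fps_const_mult)
    qed
    then show ?thesis
      by (simp add: v_def fps_nth_X_power_mult_binomial)
  qed
  have coeff_z: "((1 + fps_const u * z) ^ t * (1 + fps_const v * z) ^ t) $ k =
      (\<Sum>x\<le>k. of_nat (t choose x) * of_nat (t choose (k - x)) * (u ^ x * v ^ (k - x)))" for t k
    unfolding z_def fps_mult_nth fps_nth_binomial_linear atLeast0AtMost
    by (simp only: mult_ac)

  have coeff_monomial: "(u ^ i * v ^ j) $ a $ b = (if i = b \<and> j = a then 1 else 0)" for i j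
    using coeff_uv [of i 0 j 0] by (auto simp: not_le dest: le_neq_implies_less)
  have coeff_of_nat: "(of_nat p * of_nat q * f) $ a $ b = int p * int q * f $ a $ b"
    for p q and f :: "int fps fps"
    by (simp add: fps_of_nat [symmetric] mult.assoc)

  have "A - z * fps_const B = (1 - z) * (1 - fps_const (u * v) * z)"
    by (simp add: A_def B_def algebra_simps flip: fps_const_mult fps_const_add)
  then have "(1 - z) * (1 - fps_const (u * v) * z) * P = A ^ Suc N - (z * fps_const B) ^ Suc N"
    unfolding P_def by (subst diff_power_eq_sum) (simp add: mult_ac)
  then have "(1 - fps_X) * (1 - fps_const (u * v) * fps_X) * P =
      A ^ Suc N + fps_X ^ Suc N * (- (fps_const B ^ Suc N))"
    by (simp add: z_def power_mult_distrib del: power_Suc)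
  then have "P $ (N - c) = (\<Sum>m\<le>N - c. (u * v) ^ m * (\<Sum>k\<le>N - c - m. (A ^ Suc N) $ k))"
    by (rule fps_nth_quotient_by_one_minus) simp
  \<comment> \<open>Reading off the monomials of \<open>A ^ Suc N\<close>; for each \<open>m\<close> at most one of them,
    \<open>u^(b-m) v^(a-m) z^(a+b-2m)\<close>, survives.\<close>
  then have "P $ (N - c) $ a $ b
     = (\<Sum>m\<le>N - c. \<Sum>k\<le>N - c - m. \<Sum>i\<le>k. int (Suc N choose i) * int (Suc N choose (k - i)) *
          (if m + i = b \<and> m + (k - i) = a then 1 else 0))"
  proof -
    have "((u * v) ^ m * (A ^ Suc N) $ k) $ a $ b = (\<Sum>i\<le>k. int (Suc N choose i) * int (Suc N choose (k - i)) *
          (if m + i = b \<and> m + (k - i) = a then 1 else 0))" for m k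
    proof -
      have "(u * v) ^ m * (A ^ Suc N) $ k = (\<Sum>i\<le>k. of_nat (Suc N choose i) * of_nat (Suc N choose (k - i)) *
               (u ^ (m + i) * v ^ (m + (k - i))))"
        unfolding A_def power_mult_distrib coeff_z sum_distrib_left
        by (simp only: power_add power_mult_distrib mult_ac)
      then show ?thesis
        by (simp only: fps_sum_nth coeff_of_nat coeff_monomial)
    qed
    then show ?thesis
      unfolding \<open>P $ (N - c) = _\<close> by (simp only: fps_sum_nth sum_distrib_left)
  qed
  also have "\<dots> = (\<Sum>m\<le>b. int (Suc N choose (b - m)) * int (Suc N choose (a - m)))"
  proof -
    have "(\<Sum>i\<le>k. int (Suc N choose i) * int (Suc N choose (k - i)) *
            (if m + i = b \<and> m + (k - i) = a then 1 else 0))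
        = (if k = a + b - 2 * m then
             if m \<le> b then int (Suc N choose (b - m)) * int (Suc N choose (a - m)) else 0 else 0)"
      (is "?S = ?rhs") for m k
    proof -
      have "?S = (\<Sum>i\<le>k. if i = b - m then ?rhs else 0)"
      proof (intro sum.cong refl)
        fix i assume "i \<in> {..k}"
        then have "m + i = b \<and> m + (k - i) = a \<longleftrightarrow> i = b - m \<and> m \<le> b \<and> k = a + b - 2 * m"
          using assms(1) by auto
        moreover have "a + b - 2 * m - (b - m) = a - m" if "m \<le> b"
          using that assms(1) by linarith
        ultimately show "int (Suc N choose i) * int (Suc N choose (k - i)) *
              (if m + i = b \<and> m + (k - i) = a then 1 else 0) = (if i = b - m then ?rhs else 0)"
          by (simp del: binomial_Suc_Suc)
      qed
      also have "\<dots> = ?rhs"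
        using assms(1) by (simp add: sum.delta del: binomial_Suc_Suc)
      finally show ?thesis .
    qed
    then have "(\<Sum>m\<le>N - c. \<Sum>k\<le>N - c - m. \<Sum>i\<le>k. int (Suc N choose i) * int (Suc N choose (k - i)) *
          (if m + i = b \<and> m + (k - i) = a then 1 else 0))
       = (\<Sum>m\<le>N - c. \<Sum>k\<le>N - c - m. if k = a + b - 2 * m then
             if m \<le> b then int (Suc N choose (b - m)) * int (Suc N choose (a - m)) else 0 else 0)"
      by (simp only:)
    also have "\<dots> = (\<Sum>m\<le>N - c. if m \<le> b then int (Suc N choose (b - m)) * int (Suc N choose (a - m)) else 0)"
      (is "_ = (\<Sum>m\<le>_. ?t m)")
    proof (intro sum.cong refl)
      fix m assume "m \<in> {..N - c}"
      then have "a + b - 2 * m \<in> {..N - c - m}"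
        using assms(2) by auto
      then show "(\<Sum>k\<le>N - c - m. if k = a + b - 2 * m then ?t m else 0) = ?t m"
        by (simp only: sum.delta finite_atMost if_True)
    qed
    also have "\<dots> = (\<Sum>m\<le>b. int (Suc N choose (b - m)) * int (Suc N choose (a - m)))"
      using assms(2) by (intro sum.mono_neutral_cong_right) auto
    finally show ?thesis .
  qed
  finally have coeff_from_factorisation: "P $ (N - c) $ a $ b = \<dots>" .

  \<comment> \<open>The terms of \<open>P\<close> with \<open>t < c\<close> are divisible by \<open>z^(N-c+1)\<close>, so that the sum starts at \<open>t = c\<close>.\<close>
  have "P $ (N - c) $ a $ b = (\<Sum>t=c..N. \<Sum>x\<le>t - c. if x \<le> b \<and> t - c - x \<le> a
       then int (g t x (t - c - x)) else 0)"
  proof -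
    have "(A ^ t * (z * fps_const B) ^ (N - t)) $ (N - c) $ a $ b =
       (if c \<le> t then \<Sum>x\<le>t - c. if x \<le> b \<and> t - c - x \<le> a
           then int (g t x (t - c - x)) else 0 else 0)" if "t \<le> N" for t
    proof -
      have "A ^ t * (z * fps_const B) ^ (N - t) = fps_X ^ (N - t) * (fps_const (B ^ (N - t)) * A ^ t)"
        by (simp add: z_def power_mult_distrib mult_ac)
      then have "(A ^ t * (z * fps_const B) ^ (N - t)) $ (N - c) =
          (if c \<le> t then B ^ (N - t) * (A ^ t) $ (t - c) else 0)"
        using that assms(2) by (simp only: fps_X_power_mult_nth fps_mult_left_const_nth) auto
      moreover have "(B ^ (N - t) * (A ^ t) $ k) $ a $ b =
          (\<Sum>x\<le>k. if x \<le> b \<and> k - x \<le> a then int (g t x (k - x)) else 0)" for k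
      proof -
        have "B ^ (N - t) * (A ^ t) $ k =
            (\<Sum>x\<le>k. of_nat (t choose x) * of_nat (t choose (k - x)) *
               ((u ^ x * (1 + u) ^ (N - t)) * (v ^ (k - x) * (1 + v) ^ (N - t))))"
          unfolding A_def B_def power_mult_distrib coeff_z sum_distrib_left
          by (simp only: mult_ac)
        then show ?thesis
          unfolding g_def by (simp only: fps_sum_nth coeff_of_nat coeff_uv) (intro sum.cong refl, simp)
      qed
      ultimately show ?thesis by simp
    qed
    then have "P $ (N - c) $ a $ b = (\<Sum>t<Suc N. if c \<le> t then \<Sum>x\<le>t - c. if x \<le> b \<and> t - c - x \<le> a
           then int (g t x (t - c - x)) else 0 else 0)"
      unfolding P_def fps_sum_nth by (intro sum.cong) auto
    also have "\<dots> = (\<Sum>t=c..N. \<Sum>x\<le>t - c. if x \<le> b \<and> t - c - x \<le> a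
       then int (g t x (t - c - x)) else 0)"
      by (intro sum.mono_neutral_cong_right) auto
    finally show ?thesis .
  qed
  also have "\<dots> = (\<Sum>x\<le>b. \<Sum>y\<le>a. int (g (c + x + y) x y))"
  proof -
    have "(\<Sum>t=c..N. \<Sum>x\<le>t - c. if x \<le> b \<and> t - c - x \<le> a then int (g t x (t - c - x)) else 0)
      = (\<Sum>t=c..N. \<Sum>x\<in>{x. x \<le> t - c \<and> x \<le> b \<and> t - c - x \<le> a}. int (g t x (t - c - x)))"
      by (intro sum.cong refl sum.mono_neutral_cong_right) auto
    also have "\<dots> = (\<Sum>(t, x)\<in>(SIGMA t:{c..N}. {x. x \<le> t - c \<and> x \<le> b \<and> t - c - x \<le> a}).
        int (g t x (t - c - x)))"
      by (intro sum.Sigma) auto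
    also have "\<dots> = (\<Sum>(x, y)\<in>{..b} \<times> {..a}. int (g (c + x + y) x y))"
      using assms(2)
      by (intro sum.reindex_bij_witness
          [of _ "\<lambda>(x, y). (c + x + y, x)" "\<lambda>(t, x). (x, t - c - x)"]) auto
    also have "\<dots> = (\<Sum>x\<le>b. \<Sum>y\<le>a. int (g (c + x + y) x y))"
      by (intro sum.Sigma [symmetric]) auto
    finally show ?thesis .
  qed
  finally have "int (\<Sum>x\<le>b. \<Sum>y\<le>a. g (c + x + y) x y)
       = int (\<Sum>m\<le>b. (Suc N choose (b - m)) * (Suc N choose (a - m)))"
    using coeff_from_factorisation by simp
  then show ?thesis by (simp only: of_nat_eq_iff)
qed

section \<open>From hypergeometric terms to binomial coefficients\<close>

lemma pochhammer_neg_of_nat: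
  "k \<le> n \<Longrightarrow> pochhammer (- real n) k = (-1) ^ k * fact n / fact (n - k)"
proof (induction k)
  case (Suc k)
  then have "fact (n - k) = (real n - real k) * fact (n - Suc k)"
    by (simp add: fact_reduce [of "n - k"] of_nat_diff)
  with Suc show ?case
    by (simp add: pochhammer_Suc field_simps)
qed simp

lemma pochhammer_of_nat_plus_one:
  "pochhammer (real n + 1) k = fact (n + k) / fact n"
  using pochhammer_product' [of "1::real" n k] by (simp add: field_simps flip: pochhammer_fact)

text \<open>
  The parameters are written as sums, \<open>a = k + y\<close>, \<open>b = n + p\<close>, \<open>N = a + b + c + d\<close>, so that every
  factorial below has a subtraction-free argument and the identity reduces to cancelling common
  factors. The symmetry \<open>C(N,b) C(b,n) C(N-b,t-n) = C(N,t) C(t,n) C(N-t,b-n)\<close>, applied once to \<open>b\<close> and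
  once to \<open>a\<close>, is what removes the squared binomial coefficient in the denominator.
\<close>
lemma hypergeometric_term_eq_binomials:
  fixes n p k y c d :: nat
  defines "a \<equiv> k + y" and "b \<equiv> n + p"
  defines "N \<equiv> a + b + c + d" and "t \<equiv> c + n + y"
  shows "real ((N - b) choose (a + c)) * real ((N - a) choose c) / (real (N choose (a + c)))\<^sup>2 *
     ((pochhammer (- real b) n * pochhammer (real c + real a - real N) n *
         pochhammer (real a + real c + 1) n * pochhammer (real a + real c + 1) n) /
        (fact n * pochhammer (real c + 1) n *
         pochhammer (real a + real c - real N) n * pochhammer (real a + real c - real N) n) *
      ((pochhammer (- real a) k * pochhammer (- real a - real c) k *
          pochhammer (real N - real a - real c - real n + 1) k *
          pochhammer (real N - real a - real c - real n + 1) k) /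
        (pochhammer (real N - real a - real b - real c + 1) k *
         pochhammer (- real a - real c - real n) k * pochhammer (- real a - real c - real n) k * fact k))) *
     real (N choose a) * real (N choose b) =
     real ((t choose n) * (t choose y) * ((N - t) choose p) * ((N - t) choose k))"
proof -
  have args: "real c + real a - real N = - real (b + d)" "real a + real c - real N = - real (b + d)"
    "real a + real c + 1 = real (a + c) + 1" "- real a - real c = - real (a + c)"
    "real N - real a - real c - real n + 1 = real (d + p) + 1"
    "real N - real a - real b - real c + 1 = real d + 1"
    "- real (a + c) - real n = - real (a + c + n)"
    by (simp_all add: N_def b_def)
  have poch:
    "pochhammer (- real b) n = (-1) ^ n * fact b / fact p"
    "pochhammer (- real (b + d)) n = (-1) ^ n * fact (b + d) / fact (d + p)"
    "pochhammer (- real a) k = (-1) ^ k * fact a / fact y"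
    "pochhammer (- real (a + c)) k = (-1) ^ k * fact (a + c) / fact (c + y)"
    "pochhammer (- real (a + c + n)) k = (-1) ^ k * fact (a + c + n) / fact t"
    by (simp_all add: pochhammer_neg_of_nat a_def b_def t_def add_ac del: of_nat_add)
  have binom:
    "real ((N - b) choose (a + c)) = fact (a + c + d) / (fact (a + c) * fact d)"
    "real ((N - a) choose c) = fact (b + c + d) / (fact c * fact (b + d))"
    "real (N choose (a + c)) = fact N / (fact (a + c) * fact (b + d))"
    "real (N choose a) = fact N / (fact a * fact (b + c + d))"
    "real (N choose b) = fact N / (fact b * fact (a + c + d))"
    "real (t choose n) = fact t / (fact n * fact (c + y))"
    "real (t choose y) = fact t / (fact y * fact (c + n))"
    "real ((N - t) choose p) = fact (d + p + k) / (fact p * fact (d + k))"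
    "real ((N - t) choose k) = fact (d + p + k) / (fact k * fact (d + p))"
    by (simp_all add: binomial_fact N_def a_def b_def t_def add_ac)
  show ?thesis
    unfolding args poch pochhammer_of_nat_plus_one of_nat_mult binom power2_eq_square
    by (simp add: divide_simps)
qed

lemma hyp_double_sum_eq_sum_binomial_products:
  assumes "a + b + c \<le> N"
  shows "hyp_double_sum N a b c * real (N choose a) * real (N choose b) =
    (\<Sum>x\<le>b. \<Sum>y\<le>a. real (((c + x + y) choose x) * ((c + x + y) choose y) *
        ((N - (c + x + y)) choose (b - x)) * ((N - (c + x + y)) choose (a - y))))"
    (is "_ = (\<Sum>x\<le>b. \<Sum>y\<le>a. ?g x y)")
proof -
  have "hyp_double_sum N a b c * real (N choose a) * real (N choose b)
      = (\<Sum>x\<le>b. \<Sum>k\<le>a. ?g x (a - k))"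
    unfolding hyp_double_sum_def hyp_4F3_terminating sum_distrib_left sum_distrib_right atLeast0AtMost
      power_one mult_1_right
  proof (intro sum.cong refl)
    fix n k assume "n \<in> {..b}" "k \<in> {..a}"
    moreover obtain d where "N = a + b + c + d"
      using assms le_Suc_ex by blast
    ultimately show "(real ((N - b) choose (a + c)) * real ((N - a) choose c) / (real (N choose (a + c)))\<^sup>2 *
     ((pochhammer (- real b) n * pochhammer (real c + real a - real N) n *
         pochhammer (real a + real c + 1) n * pochhammer (real a + real c + 1) n) /
        (fact n * pochhammer (real c + 1) n *
         pochhammer (real a + real c - real N) n * pochhammer (real a + real c - real N) n) *
      ((pochhammer (- real a) k * pochhammer (- real a - real c) k *
          pochhammer (real N - real a - real c - real n + 1) k *
          pochhammer (real N - real a - real c - real n + 1) k) /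
        (pochhammer (real N - real a - real b - real c + 1) k *
         pochhammer (- real a - real c - real n) k * pochhammer (- real a - real c - real n) k * fact k)))) *
     real (N choose a) * real (N choose b) = ?g n (a - k)"
      using hypergeometric_term_eq_binomials [of k "a - k" n "b - n" c d] by simp
  qed
  also have "\<dots> = (\<Sum>x\<le>b. \<Sum>y\<le>a. ?g x y)"
    by (intro sum.cong refl sum.reindex_bij_witness [of _ "\<lambda>y. a - y" "\<lambda>y. a - y"]) auto
  finally show ?thesis .
qed

text \<open>
  The two sides agree term by term: the quotient \<open>a! (N-a+1)! / ((a-m)! (N-a+1+m)!)\<close> is
  \<open>C(N+1,a-m) / C(N+1,a)\<close>, and \<open>(N-a+1) C(N+1,a) = (N+1) C(N,a)\<close> absorbs the prefactor.
\<close>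
lemma pochhammer_sum_eq_sum_binomial_products:
  assumes "b \<le> a" and "a + b \<le> N"
  shows "(real N + 1) / (real N - real a + 1) * inverse (real (N choose b)) *
           (\<Sum>m = 0..b.
              (pochhammer (- real a) m * pochhammer (real N - real b + real m + 2) (b - m) * (-1) ^ m) /
              (pochhammer (real N - real a + 2) m * fact (b - m))) * real (N choose a) * real (N choose b)
    = (\<Sum>m\<le>b. real ((Suc N choose (b - m)) * (Suc N choose (a - m))))"
proof -
  have "(real N + 1) / (real N - real a + 1) * inverse (real (N choose b)) *
            ((pochhammer (- real a) m * pochhammer (real N - real b + real m + 2) (b - m) * (-1) ^ m) /
              (pochhammer (real N - real a + 2) m * fact (b - m))) * real (N choose a) * real (N choose b)
    = real ((Suc N choose (b - m)) * (Suc N choose (a - m)))" if "m \<le> b" for m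
  proof -
    define e f where "e = N - a" and "f = N - b"
    have Ne: "N = a + e" and Nf: "N = b + f"
      using assms by (simp_all add: e_def f_def)
    have args: "real N - real b + real m + 2 = real (f + m + 1) + 1"
      "real N - real a + 2 = real (e + 1) + 1" "real N - real a + 1 = real (e + 1)"
      "real N + 1 = real (N + 1)"
      using Ne Nf by simp_all
    have poch: "pochhammer (- real a) m = (-1) ^ m * fact a / fact (a - m)"
      "pochhammer (real (f + m + 1) + 1) (b - m) = fact (N + 1) / fact (f + m + 1)"
      "pochhammer (real (e + 1) + 1) m = fact (e + 1 + m) / fact (e + 1)"
      unfolding pochhammer_of_nat_plus_one using that assms(1) Nf
      by (simp_all add: pochhammer_neg_of_nat add_ac del: fact_Suc)
    have diffs: "Suc N - (b - m) = f + m + 1" "Suc N - (a - m) = e + 1 + m"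
      using that assms(1) Ne Nf by auto
    have binom: "real (N choose a) = fact N / (fact a * fact e)"
      "real (Suc N choose (b - m)) = fact (N + 1) / (fact (b - m) * fact (f + m + 1))"
      "real (Suc N choose (a - m)) = fact (N + 1) / (fact (a - m) * fact (e + 1 + m))"
      using that assms Ne diffs by (simp_all add: binomial_fact del: fact_Suc)
    have "real (N choose b) \<noteq> 0" using assms by simp
    then show ?thesis
      unfolding args poch of_nat_mult binom
      by (simp add: divide_simps)
  qed
  then show ?thesis
    unfolding sum_distrib_left sum_distrib_right atLeast0AtMost by (intro sum.cong) auto
qed

theorem corollaryA3:
  fixes N a b c :: nat
  assumes "a \<le> N" and "b \<le> N" and "b \<le> a" and "a + b \<le> N" and "c \<le> N - a - b"
  shows "hyp_double_sum N a b c =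
           (real N + 1) / (real N - real a + 1) * inverse (real (N choose b)) *
           (\<Sum>m = 0..b.
              (pochhammer (- real a) m * pochhammer (real N - real b + real m + 2) (b - m) * (-1) ^ m) /
              (pochhammer (real N - real a + 2) m * fact (b - m)))
       \<and> (\<forall>c'. c' \<le> N - a - b \<longrightarrow> hyp_double_sum N a b c' = hyp_double_sum N a b c)"
proof -
  have "hyp_double_sum N a b c' =
           (real N + 1) / (real N - real a + 1) * inverse (real (N choose b)) *
           (\<Sum>m = 0..b.
              (pochhammer (- real a) m * pochhammer (real N - real b + real m + 2) (b - m) * (-1) ^ m) /
              (pochhammer (real N - real a + 2) m * fact (b - m)))" (is "_ = ?rhs")
    if "c' \<le> N - a - b" for c'
  proof -
    have le: "a + b + c' \<le> N" using that assms(4) by linarith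
    have "hyp_double_sum N a b c' * real (N choose a) * real (N choose b)
        = ?rhs * real (N choose a) * real (N choose b)"
      unfolding pochhammer_sum_eq_sum_binomial_products [OF assms(3,4)]
        hyp_double_sum_eq_sum_binomial_products [OF le] of_nat_sum [symmetric]
        sum_binomial_products_shift_invariant [OF assms(3) le] ..
    moreover have "real (N choose a) \<noteq> 0" "real (N choose b) \<noteq> 0"
      using assms(1,2) by simp_all
    ultimately show ?thesis by (simp only: mult_cancel_right simp_thms)
  qed
  with assms(5) show ?thesis by simp
qed

end
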